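(* Let $n \le m$, let $A \in \mathbb{R}^{n\times m}$ have full rank $n$, and let $b \in \mathbb{R}^n$ be such that the system $As=b$ has at least one solution $s'$ with $s'_j \neq 0$ for every $j=1,\ldots,m$. Then \[ \min\{\|s\|_1 \,:\, As=b,\ s\in\mathbb{R}^m\} \;=\; \inf\Big\{ \tfrac{1}{2}\mathbf{1}^\top x + \tfrac{1}{2} b^\top (A\,\mathrm{diag}(x)\,A^\top)^{-1} b \,:\, x \in \mathbb{R}^m_{>0}\Big\}. \]
   Context: $\mathrm{diag}(x)$ is the $m\times m$ diagonal matrix with the entries of $x$ on its diagonal; $\mathbb{R}^m_{>0}$ is the open positive orthant. The first problem is called basis pursuit (BP), the second dissipation minimization (DM). *)

theory Defs
  imports "HOL-Analysis.Analysis"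
begin

definition l1_norm :: "real ^ 'm \<Rightarrow> real" where
  "l1_norm s = (\<Sum>j\<in>UNIV. \<bar>s $ j\<bar>)"

definition diag :: "real ^ 'm \<Rightarrow> real ^ 'm ^ 'm" where
  "diag x = (\<chi> i j. if i = j then x $ i else 0)"

definition pos_orthant :: "(real ^ 'm) set" where
  "pos_orthant = {x. \<forall>j. x $ j > 0}"

(* The numeral 1 below is the all-ones vector of real ^ 'm. *)
definition dissipation :: "real ^ 'm ^ 'n \<Rightarrow> real ^ 'n \<Rightarrow> real ^ 'm \<Rightarrow> real" where
  "dissipation A b x =
     1/2 * ((1 :: real ^ 'm) \<bullet> x)
     + 1/2 * (b \<bullet> (matrix_inv (A ** diag x ** transpose A) *v b))"

end

theory Submission
  imports Defs
begin

text \<open>For \<open>x\<close> in the positive orthant let \<open>y\<close> solve \<open>A diag(x) A\<^sup>T y = b\<close>. The vector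
  \<open>diag(x) A\<^sup>T y\<close> is feasible and minimises the weighted energy \<open>\<Sum>j. s\<^sub>j\<^sup>2 / x\<^sub>j\<close>
  over all feasible \<open>s\<close>, with minimum \<open>b \<bullet> y\<close>. Hence the dissipation at \<open>x\<close> is the minimum over
  feasible \<open>s\<close> of \<open>\<Sum>j. (x\<^sub>j + s\<^sub>j\<^sup>2 / x\<^sub>j) / 2\<close>, which by AM-GM is at least the
  \<open>l\<^sub>1\<close> norm of \<open>s\<close>, and which is almost attained at \<open>x\<^sub>j = \<bar>s\<^sub>j\<bar> + \<epsilon>\<close>.\<close>

lemma norm_le_l1_norm: "norm s \<le> l1_norm s"
  using norm_le_l1_cart[of s] by (simp add: l1_norm_def)

lemma continuous_on_l1_norm: "continuous_on S l1_norm"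
  unfolding l1_norm_def by (intro continuous_intros)

text \<open>Since \<open>norm\<close> is bounded by \<open>l1_norm\<close>, all points of
  \<open>S\<close> that do at least as well as a fixed \<open>s0\<close> lie in a ball. Compactness
  gives a minimiser there, and every point outside the ball does worse than
  \<open>s0\<close>.\<close>

lemma ex_is_arg_min_l1_norm:
  fixes S :: "(real ^ 'm) set"
  assumes "closed S" "S \<noteq> {}"
  shows "\<exists>s. is_arg_min l1_norm (\<lambda>s. s \<in> S) s"
proof -
  from assms obtain s0 where s0: "s0 \<in> S" by blast
  let ?K = "S \<inter> cball 0 (l1_norm s0)"
  have K: "compact ?K" "?K \<noteq> {}"
    using assms(1) s0 norm_le_l1_norm[of s0] by (auto simp: closed_Int_compact)
  obtain s where s: "s \<in> ?K" "\<forall>t\<in>?K. l1_norm s \<le> l1_norm t"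
    using continuous_attains_inf[OF K continuous_on_l1_norm] by blast
  have "l1_norm s \<le> l1_norm t" if t: "t \<in> S" for t
  proof (cases "l1_norm t \<le> l1_norm s0")
    case True
    then have "t \<in> ?K" using t norm_le_l1_norm[of t] by auto
    then show ?thesis using s(2) by blast
  next
    case False
    moreover have "s0 \<in> ?K" using s0 norm_le_l1_norm[of s0] by auto
    ultimately show ?thesis using s(2) by (meson nle_le order_trans)
  qed
  then show ?thesis using s(1) by (auto simp: is_arg_min_linorder)
qed

lemma diag_mult_vec_nth: "(diag x *v v) $ j = x $ j * v $ j"
proof -
  have "(diag x *v v) $ j = (\<Sum>i\<in>UNIV. if j = i then x $ j * v $ i else 0)"
    unfolding diag_def matrix_vector_mult_def vec_lambda_beta by (rule sum.cong) auto
  then show ?thesis by simp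
qed

lemma weighted_gram_mult_vec:
  "(A ** diag x ** transpose A) *v y = A *v (diag x *v (transpose A *v y))"
  by (simp only: matrix_vector_mul_assoc matrix_mul_assoc)

text \<open>Moving \<open>A\<close> across the inner product leaves a diagonal quadratic form in
  \<open>transpose A *v y\<close>. This serves both for definiteness and, when \<open>y\<close>
  solves the system, for rewriting \<open>b \<bullet> y\<close>.\<close>

lemma inner_weighted_gram:
  "y \<bullet> ((A ** diag x ** transpose A) *v y) = (\<Sum>j\<in>UNIV. x $ j * ((transpose A *v y) $ j)\<^sup>2)"
  for A :: "real ^ 'm ^ 'n"
proof -
  have "y \<bullet> ((A ** diag x ** transpose A) *v y)
      = (transpose A *v y) \<bullet> (diag x *v (transpose A *v y))"
    unfolding weighted_gram_mult_vec by (simp add: dot_lmul_matrix[symmetric])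
  then show ?thesis
    by (simp add: inner_vec_def diag_mult_vec_nth power2_eq_square algebra_simps)
qed

text \<open>The kernel is trivial: the quadratic form has positive weights, so its vanishing forces
  \<open>transpose A *v y = 0\<close>, and full row rank makes the transpose injective.\<close>

lemma invertible_weighted_gram:
  fixes A :: "real ^ 'm ^ 'n"
  assumes "rank A = CARD('n)" "x \<in> pos_orthant"
  shows "invertible (A ** diag x ** transpose A)"
proof -
  have inj: "inj ((*v) (transpose A))"
    using assms(1) by (simp add: full_rank_injective[symmetric] rank_transpose)
  have "y = 0" if "(A ** diag x ** transpose A) *v y = 0" for y
  proof -
    have "(\<Sum>j\<in>UNIV. x $ j * ((transpose A *v y) $ j)\<^sup>2) = 0"
      using that inner_weighted_gram[of y A x] by simp
    then have "\<forall>j. x $ j * ((transpose A *v y) $ j)\<^sup>2 = 0"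
      using assms(2) by (subst (asm) sum_nonneg_eq_0_iff) (auto simp: pos_orthant_def less_imp_le)
    then have "transpose A *v y = 0"
      using assms(2) by (auto simp: vec_eq_iff pos_orthant_def) (metis less_irrefl)
    then show "y = 0"
      using inj by (metis injD matrix_vector_mult_0_right)
  qed
  then show ?thesis
    by (simp add: invertible_left_inverse matrix_left_invertible_ker)
qed

lemma mult_matrix_inv_vec:
  fixes M :: "real ^ 'n ^ 'n"
  assumes "invertible M"
  shows "M *v (matrix_inv M *v b) = b"
proof -
  have "M ** matrix_inv M = mat 1"
    using assms unfolding invertible_def matrix_inv_def by (rule someI2_ex) blast
  then show ?thesis by (simp add: matrix_vector_mul_assoc)
qed

lemma l1_norm_le_dissipation:
  fixes A :: "real ^ 'm ^ 'n"
  assumes "rank A = CARD('n)" "x \<in> pos_orthant"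
  shows "\<exists>s. A *v s = b \<and> l1_norm s \<le> dissipation A b x"
proof -
  define y where "y = matrix_inv (A ** diag x ** transpose A) *v b"
  define s where "s = diag x *v (transpose A *v y)"
  let ?w = "transpose A *v y"
  have My: "(A ** diag x ** transpose A) *v y = b"
    unfolding y_def using assms by (intro mult_matrix_inv_vec invertible_weighted_gram)
  then have "A *v s = b"
    unfolding s_def weighted_gram_mult_vec .
  moreover have "l1_norm s \<le> dissipation A b x"
  proof -
    have "\<bar>s $ j\<bar> \<le> 1/2 * (x $ j) + 1/2 * (x $ j * (?w $ j)\<^sup>2)" for j
    proof -
      have x: "x $ j > 0" using assms(2) by (simp add: pos_orthant_def)
      \<comment> \<open>AM-GM in disguise: \<open>\<bar>s $ j\<bar>\<close> equals
        \<open>x $ j * \<bar>?w $ j\<bar>\<close>, which is half the cross term of the expanded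
        square.\<close>
      have "0 \<le> x $ j * (\<bar>?w $ j\<bar> - 1)\<^sup>2" using x by simp
      then show ?thesis
        using x by (simp add: s_def diag_mult_vec_nth abs_mult power2_diff algebra_simps)
    qed
    then have "l1_norm s \<le> (\<Sum>j\<in>UNIV. 1/2 * (x $ j) + 1/2 * (x $ j * (?w $ j)\<^sup>2))"
      unfolding l1_norm_def by (rule sum_mono)
    also have "\<dots> = 1/2 * (1 \<bullet> x) + 1/2 * (y \<bullet> b)"
      unfolding My[symmetric] inner_weighted_gram
      by (simp add: inner_vec_def sum.distrib sum_divide_distrib)
    finally show ?thesis
      by (simp add: dissipation_def y_def[symmetric] inner_commute)
  qed
  ultimately show ?thesis by blast
qed

text \<open>Feasibility of \<open>s\<close> turns \<open>b \<bullet> y\<close> into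
  \<open>?w \<bullet> s\<close>, and Young's inequality with weights \<open>x\<close> bounds this by
  the two energies.\<close>

lemma inner_matrix_inv_le_weighted_energy:
  fixes A :: "real ^ 'm ^ 'n"
  assumes "rank A = CARD('n)" "x \<in> pos_orthant" "A *v s = b"
  shows "b \<bullet> (matrix_inv (A ** diag x ** transpose A) *v b) \<le> (\<Sum>j\<in>UNIV. (s $ j)\<^sup>2 / x $ j)"
proof -
  define y where "y = matrix_inv (A ** diag x ** transpose A) *v b"
  let ?w = "transpose A *v y"
  have My: "(A ** diag x ** transpose A) *v y = b"
    unfolding y_def using assms by (intro mult_matrix_inv_vec invertible_weighted_gram)
  have energy: "b \<bullet> y = (\<Sum>j\<in>UNIV. x $ j * (?w $ j)\<^sup>2)"
    using inner_weighted_gram[of y A x] by (simp add: My inner_commute)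
  \<comment> \<open>Doubled because the bound on the right contains one copy of
    \<open>b \<bullet> y\<close>, by \<open>energy\<close>, which then cancels.\<close>
  have "2 * (b \<bullet> y) = 2 * (?w \<bullet> s)"
    using assms(3) by (metis dot_lmul_matrix inner_commute transpose_matrix_vector)
  also have "\<dots> = (\<Sum>j\<in>UNIV. 2 * (?w $ j * s $ j))"
    by (simp add: inner_vec_def sum_distrib_left)
  also have "\<dots> \<le> (\<Sum>j\<in>UNIV. (s $ j)\<^sup>2 / x $ j + x $ j * (?w $ j)\<^sup>2)"
  proof (rule sum_mono)
    fix j
    have x: "x $ j > 0" using assms(2) by (simp add: pos_orthant_def)
    have "0 \<le> (s $ j - x $ j * ?w $ j)\<^sup>2 / x $ j" using x by simp
    also have "\<dots> = (s $ j)\<^sup>2 / x $ j + x $ j * (?w $ j)\<^sup>2 - 2 * (?w $ j * s $ j)"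
      using x by (simp add: field_simps power2_eq_square)
    finally show "2 * (?w $ j * s $ j) \<le> (s $ j)\<^sup>2 / x $ j + x $ j * (?w $ j)\<^sup>2" by simp
  qed
  also have "\<dots> = (\<Sum>j\<in>UNIV. (s $ j)\<^sup>2 / x $ j) + b \<bullet> y"
    by (simp add: sum.distrib energy)
  finally show ?thesis by (simp add: y_def)
qed

lemma dissipation_le_l1_norm_plus:
  fixes A :: "real ^ 'm ^ 'n"
  assumes "rank A = CARD('n)" "A *v s = b" "\<epsilon> > 0"
  shows "\<exists>x\<in>pos_orthant. dissipation A b x \<le> l1_norm s + \<epsilon>"
proof -
  \<comment> \<open>The shift by \<delta> keeps \<open>x\<close> positive where \<open>s\<close>
    vanishes. Summed over all coordinates and halved, it costs exactly \<epsilon>.\<close>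
  define \<delta> where "\<delta> = 2 * \<epsilon> / real CARD('m)"
  define x :: "real ^ 'm" where "x = (\<chi> j. \<bar>s $ j\<bar> + \<delta>)"
  have \<delta>: "\<delta> > 0" using assms(3) by (simp add: \<delta>_def)
  then have x: "x \<in> pos_orthant" by (simp add: x_def pos_orthant_def add_nonneg_pos)
  have "(s $ j)\<^sup>2 / x $ j \<le> \<bar>s $ j\<bar>" for j
  proof -
    have "(s $ j)\<^sup>2 \<le> \<bar>s $ j\<bar> * (\<bar>s $ j\<bar> + \<delta>)"
      using \<delta> by (simp add: power2_eq_square distrib_left)
    then show ?thesis
      using \<delta> by (simp add: x_def pos_divide_le_eq add_nonneg_pos)
  qed
  then have "(\<Sum>j\<in>UNIV. (s $ j)\<^sup>2 / x $ j) \<le> l1_norm s"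
    unfolding l1_norm_def by (rule sum_mono)
  moreover have "1 \<bullet> x = l1_norm s + 2 * \<epsilon>"
    by (simp add: x_def inner_vec_def l1_norm_def sum.distrib \<delta>_def)
  ultimately have "dissipation A b x \<le> l1_norm s + \<epsilon>"
    using inner_matrix_inv_le_weighted_energy[OF assms(1) x assms(2)]
    unfolding dissipation_def by linarith
  then show ?thesis using x by blast
qed

theorem theorem3p1:
  fixes A :: "real ^ 'm ^ 'n" and b :: "real ^ 'n"
  assumes "CARD('n) \<le> CARD('m)"
    and "rank A = CARD('n)"
    and "\<exists>s'. A *v s' = b \<and> (\<forall>j. s' $ j \<noteq> 0)"
  shows "\<exists>s. is_arg_min l1_norm (\<lambda>s. A *v s = b) s
           \<and> ereal (l1_norm s) = (INF x\<in>pos_orthant. ereal (dissipation A b x))"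
proof -
  have "closed {s. A *v s = b}"
    by (intro closed_Collect_eq continuous_intros)
  moreover have "{s. A *v s = b} \<noteq> {}" using assms(3) by blast
  ultimately obtain s where s: "is_arg_min l1_norm (\<lambda>s. A *v s = b) s"
    using ex_is_arg_min_l1_norm[of "{s. A *v s = b}"] by auto
  then have feasible: "A *v s = b" and minimal: "\<And>t. A *v t = b \<Longrightarrow> l1_norm s \<le> l1_norm t"
    by (auto simp: is_arg_min_linorder)
  have "ereal (l1_norm s) = (INF x\<in>pos_orthant. ereal (dissipation A b x))"
  proof (rule antisym)
    show "ereal (l1_norm s) \<le> (INF x\<in>pos_orthant. ereal (dissipation A b x))"
      using l1_norm_le_dissipation[OF assms(2)] minimal
      by (intro INF_greatest) (metis ereal_less_eq(3) order_trans)
    show "(INF x\<in>pos_orthant. ereal (dissipation A b x)) \<le> ereal (l1_norm s)"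
    \<comment> \<open>The minimiser may have zero coordinates, so its absolute values need not lie
      in the open orthant; the bound is therefore approached up to \<epsilon>.\<close>
    proof (rule ereal_le_epsilon2)
      fix \<epsilon> :: real assume "\<epsilon> > 0"
      then obtain x where "x \<in> pos_orthant" "dissipation A b x \<le> l1_norm s + \<epsilon>"
        using dissipation_le_l1_norm_plus[OF assms(2) feasible] by blast
      then show "(INF x\<in>pos_orthant. ereal (dissipation A b x)) \<le> ereal (l1_norm s) + ereal \<epsilon>"
        by (intro INF_lower2) auto
    qed
  qed
  with s show ?thesis by blast
qed

end
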